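(* In the setting of the context (with $T=1$), let $\alpha^*\equiv 0$ and let $$\hat\alpha_t := \sum_{n=0}^\infty\Big[\mathbf{1}_{[t_n,s_n)}(t)-\mathbf{1}_{[s_n,t_{n+1})}(t)\Big],\qquad t\in[0,T].$$ Then $\hat\alpha$ dominates $\alpha^*$ in the sense that $$J(t,\hat\alpha)<J(t,\alpha^* )\quad\text{for all } t\in[0,T),\qquad\text{and}\qquad J(T,\hat\alpha)=J(T,\alpha^* ).$$
   Context: Let $T=1$. For $n\ge 0$ set $t_n := 1-2^{-n}$ and $s_n := \frac14[t_n+3t_{n+1}]$, so $t_n<s_n<t_{n+1}$. Let $$c(t) := \sum_{n=0}^\infty \big[\mathbf{1}_{[t_n,s_n)}(t)+6\,\mathbf{1}_{[s_n,t_{n+1})}(t)\big],\qquad t\in[0,T].$$ The admissible control set $\mathcal{A}$ is the set of all Borel measurable functions $\alpha:[0,1]\to[-1,1]$. For $\alpha\in\mathcal{A}$ and $t\in[0,T]$ define $$Y^{1,\alpha}_t := \int_t^T \alpha_s\,ds,\qquad Y^{2,\alpha}_t := \int_t^T c(s)\,\alpha_s\,Y^{1,\alpha}_s\,ds,\qquad J(t,\alpha) := Y^{2,\alpha}_t.$$ *)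

theory Defs
  imports "HOL-Analysis.Analysis"
begin

abbreviation (input) T :: real where
  "T \<equiv> 1"

definition t_grid :: "nat \<Rightarrow> real" where
  "t_grid n = 1 - 1 / 2 ^ n"

definition s_grid :: "nat \<Rightarrow> real" where
  "s_grid n = 1 / 4 * (t_grid n + 3 * t_grid (Suc n))"

text \<open>For every argument at most one summand of the following series, and of the one for
  \<open>alpha_hat\<close> below, is nonzero, so both converge pointwise; at \<open>T\<close> both are \<open>0\<close>.\<close>

definition c :: "real \<Rightarrow> real" where
  "c t = (\<Sum>n. indicat_real {t_grid n..<s_grid n} t
              + 6 * indicat_real {s_grid n..<t_grid (Suc n)} t)"

text \<open>Controls are total functions on the reals of which only the restriction to \<open>[0, T]\<close>
  matters: \<open>J\<close> does not depend on values outside this interval when \<open>t\<close> lies in it.\<close>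

definition admissible :: "(real \<Rightarrow> real) set" where
  "admissible = {\<alpha>. \<alpha> \<in> borel_measurable (restrict_space borel {0..T})
                    \<and> \<alpha> \<in> {0..T} \<rightarrow> {-1..1}}"

definition Y1 :: "(real \<Rightarrow> real) \<Rightarrow> real \<Rightarrow> real" where
  "Y1 \<alpha> t = (LINT s:{t..T}|lborel. \<alpha> s)"

definition Y2 :: "(real \<Rightarrow> real) \<Rightarrow> real \<Rightarrow> real" where
  "Y2 \<alpha> t = (LINT s:{t..T}|lborel. c s * \<alpha> s * Y1 \<alpha> s)"

definition J :: "real \<Rightarrow> (real \<Rightarrow> real) \<Rightarrow> real" where
  "J t \<alpha> = Y2 \<alpha> t"

definition alpha_star :: "real \<Rightarrow> real" where
  "alpha_star t = 0"

definition alpha_hat :: "real \<Rightarrow> real" where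
  "alpha_hat t = (\<Sum>n. indicat_real {t_grid n..<s_grid n} t
                      - indicat_real {s_grid n..<t_grid (Suc n)} t)"

end

theory Submission
  imports Defs
begin

text \<open>
  Both coefficients \<open>c\<close> and \<open>alpha_hat\<close> repeat themselves on a dyadic scale: on \<open>[0, 1)\<close> they are
  invariant under the contraction \<open>t \<mapsto> (1 + t) / 2\<close>, which fixes \<open>1\<close> and carries
  \<open>[t_n, t_(n+1))\<close> onto \<open>[t_(n+1), t_(n+2))\<close>. Substitution in the integrals gives the scaling laws
  \<open>Y1 ((1 + t) / 2) = Y1 t / 2\<close> and \<open>Y2 ((1 + t) / 2) = Y2 t / 4\<close> for the control \<open>alpha_hat\<close>.
  Hence each integral over \<open>[0, 1]\<close> is determined by its part over the first block
  \<open>[0, 1/2] = [0, 3/8] \<union> [3/8, 1/2]\<close>. There the control is \<open>1\<close>, then \<open>-1\<close>, so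
  \<open>Y1 0 = 3/8 - 1/8 + Y1 0 / 2\<close>, that is \<open>Y1 0 = 1/2\<close>, and \<open>Y1\<close> is \<open>1/2 - t\<close>, then \<open>t - 1/4\<close>.
  The integrand of \<open>Y2\<close> contributes \<open>15/128\<close> on the first piece and, because of the weight \<open>6\<close>,
  \<open>-18/128\<close> on the second, so \<open>Y2 0 = -3/128 + Y2 0 / 4\<close>, that is \<open>Y2 0 = -1/32\<close>.
  Since \<open>Y2\<close> decreases from \<open>-1/32\<close> on the first piece and increases to \<open>-1/128\<close> on
  the second, it is negative on \<open>[0, 1/2)\<close>, and the scaling law extends this to \<open>[0, 1)\<close>. The zero
  control has cost \<open>0\<close>.
\<close>

section \<open>Self-similar step functions\<close>

lemma t_grid_Suc: "t_grid (Suc n) = (1 + t_grid n) / 2"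
  by (simp add: t_grid_def field_simps)

lemma s_grid_Suc: "s_grid (Suc n) = (1 + s_grid n) / 2"
  by (simp add: s_grid_def t_grid_Suc field_simps)

lemma t_grid_nonneg: "0 \<le> t_grid n"
  by (simp add: t_grid_def)

lemma t_grid_less_1: "t_grid n < 1"
  by (simp add: t_grid_def)

lemma t_grid_le_s_grid: "t_grid n \<le> s_grid n"
  using t_grid_less_1[of n] by (simp add: s_grid_def t_grid_Suc field_simps)

lemma s_grid_le_t_grid_Suc: "s_grid n \<le> t_grid (Suc n)"
  using t_grid_less_1[of n] by (simp add: s_grid_def t_grid_Suc field_simps)

lemma grid_0: "t_grid 0 = 0" "s_grid 0 = 3/8" "t_grid (Suc 0) = 1/2"
  by (simp_all add: t_grid_def s_grid_def)

lemma t_grid_tendsto: "t_grid \<longlonglongrightarrow> 1"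
proof -
  have "(\<lambda>n. 1 - (1/2) ^ n) \<longlonglongrightarrow> (1 - 0 :: real)"
    by (intro tendsto_intros LIMSEQ_power_zero) auto
  then show ?thesis
    by (simp add: t_grid_def[abs_def] power_one_over)
qed

text \<open>The step function with the value \<open>a\<close> on every \<open>[t_n, s_n)\<close> and \<open>b\<close> on every
  \<open>[s_n, t_(n+1))\<close>, and \<open>0\<close> outside \<open>[0, 1)\<close>; both \<open>c\<close> and \<open>alpha_hat\<close> are of this form.\<close>

definition block_step :: "real \<Rightarrow> real \<Rightarrow> real \<Rightarrow> real" where
  "block_step a b t = (\<Sum>n. a * indicat_real {t_grid n..<s_grid n} t
                          + b * indicat_real {s_grid n..<t_grid (Suc n)} t)"

lemma c_eq_block_step: "c = block_step 1 6"
  by (simp add: c_def[abs_def] block_step_def[abs_def])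

lemma alpha_hat_eq_block_step: "alpha_hat = block_step 1 (-1)"
  by (simp add: alpha_hat_def[abs_def] block_step_def[abs_def])

lemma borel_measurable_block_step [measurable]: "block_step a b \<in> borel_measurable borel"
  unfolding block_step_def[abs_def] by measurable

lemma block_step_term_eq_0:
  assumes "t < t_grid n \<or> 1 \<le> t"
  shows "a * indicat_real {t_grid n..<s_grid n} t
       + b * indicat_real {s_grid n..<t_grid (Suc n)} t = 0"
  using assms t_grid_le_s_grid[of n] s_grid_le_t_grid_Suc[of n] t_grid_less_1[of "Suc n"]
  by (auto simp: indicator_def)

lemma block_step_eq_0: "1 \<le> t \<Longrightarrow> block_step a b t = 0"
  unfolding block_step_def by (simp add: block_step_term_eq_0)

lemma summable_block_step:
  "summable (\<lambda>n. a * indicat_real {t_grid n..<s_grid n} t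
               + b * indicat_real {s_grid n..<t_grid (Suc n)} t)"
proof -
  have "\<forall>\<^sub>F n in sequentially. t < t_grid n \<or> 1 \<le> t"
  proof (cases "t < 1")
    case True
    then have "\<forall>\<^sub>F n in sequentially. t < t_grid n"
      using order_tendstoD(1)[OF t_grid_tendsto] by blast
    then show ?thesis
      by (rule eventually_mono) simp
  qed simp
  then have "\<forall>\<^sub>F n in sequentially. a * indicat_real {t_grid n..<s_grid n} t
               + b * indicat_real {s_grid n..<t_grid (Suc n)} t = 0"
    by (rule eventually_mono) (rule block_step_term_eq_0)
  from summable_cong[OF this] show ?thesis
    by simp
qed

lemma block_step_first:
  assumes "t < 1/2"
  shows "block_step a b t = a * indicat_real {0..<3/8} t + b * indicat_real {3/8..<1/2} t"
proof -
  have "t < t_grid (Suc n)" for n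
    using assms t_grid_nonneg[of n] by (simp add: t_grid_Suc)
  then have "(\<Sum>n. a * indicat_real {t_grid (Suc n)..<s_grid (Suc n)} t
       + b * indicat_real {s_grid (Suc n)..<t_grid (Suc (Suc n))} t) = 0"
    by (simp add: block_step_term_eq_0)
  then show ?thesis
    unfolding block_step_def
    using suminf_split_head[OF summable_block_step[of a t b]] by (simp add: grid_0)
qed

lemma block_step_scale:
  assumes "0 \<le> t"
  shows "block_step a b ((1 + t) / 2) = block_step a b t"
proof -
  let ?f = "\<lambda>n t. a * indicat_real {t_grid n..<s_grid n} t
               + b * indicat_real {s_grid n..<t_grid (Suc n)} t"
  have scale: "indicat_real {(1 + x) / 2..<(1 + y) / 2} ((1 + t) / 2) = indicat_real {x..<y} t"
    for x y :: real
    by (simp add: indicator_def divide_le_cancel divide_less_cancel)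
  have "?f (Suc n) ((1 + t) / 2) = ?f n t" for n
    using scale[of "t_grid n" "s_grid n"] scale[of "s_grid n" "t_grid (Suc n)"]
    by (simp only: t_grid_Suc s_grid_Suc)
  moreover have "?f 0 ((1 + t) / 2) = 0"
    using assms by (simp add: grid_0 indicator_def)
  ultimately show ?thesis
    unfolding block_step_def
    using suminf_split_head[OF summable_block_step[of a "(1 + t) / 2" b]] by simp
qed

text \<open>Induction along the scaling: a property of the points of \<open>[0, 1)\<close> has to be checked only on
  the first block and shown to be preserved by the contraction.\<close>

lemma scale_induct:
  fixes t :: real
  assumes t: "0 \<le> t" "t < 1"
    and first: "\<And>t. 0 \<le> t \<Longrightarrow> t < 1/2 \<Longrightarrow> P t"
    and scale: "\<And>t. 0 \<le> t \<Longrightarrow> t < 1 \<Longrightarrow> P t \<Longrightarrow> P ((1 + t) / 2)"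
  shows "P t"
proof -
  have "P t" if "0 \<le> t" "t < t_grid n" for n t
    using that
  proof (induction n arbitrary: t)
    case 0
    then show ?case by (simp add: grid_0)
  next
    case (Suc n)
    show ?case
    proof (cases "t < 1/2")
      case True
      with Suc.prems first show ?thesis by simp
    next
      case False
      have "2 * t - 1 < t_grid n"
        using Suc.prems by (simp add: t_grid_Suc)
      with False have "P ((1 + (2 * t - 1)) / 2)"
        using t_grid_less_1[of n] by (intro scale Suc.IH) auto
      then show ?thesis by simp
    qed
  qed
  moreover obtain n where "t < t_grid n"
    using order_tendstoD(1)[OF t_grid_tendsto t(2)] eventually_sequentially by auto
  ultimately show ?thesis using t by blast
qed

lemma block_step_cases:
  assumes "0 \<le> t"
  shows "block_step a b t \<in> {0, a, b}"
proof (cases "t < 1")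
  case True
  show ?thesis
    by (rule scale_induct[OF assms True])
      (auto simp: block_step_first block_step_scale indicator_def)
qed (simp add: block_step_eq_0)

lemma alpha_hat_scale: "0 \<le> t \<Longrightarrow> alpha_hat ((1 + t) / 2) = alpha_hat t"
  by (simp only: alpha_hat_eq_block_step block_step_scale)

lemma c_scale: "0 \<le> t \<Longrightarrow> c ((1 + t) / 2) = c t"
  by (simp only: c_eq_block_step block_step_scale)

lemma abs_alpha_hat_le: "0 \<le> t \<Longrightarrow> \<bar>alpha_hat t\<bar> \<le> 1"
  using block_step_cases[of t 1 "-1"] by (auto simp: alpha_hat_eq_block_step)

lemma abs_c_le: "0 \<le> t \<Longrightarrow> \<bar>c t\<bar> \<le> 6"
  using block_step_cases[of t 1 6] by (auto simp: c_eq_block_step)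

lemma borel_measurable_alpha_hat [measurable]: "alpha_hat \<in> borel_measurable borel"
  by (simp add: alpha_hat_eq_block_step)

lemma borel_measurable_c [measurable]: "c \<in> borel_measurable borel"
  by (simp add: c_eq_block_step)

section \<open>Scaling of tail integrals\<close>

text \<open>A function that the contraction multiplies by \<open>m\<close> has tail integrals that the contraction
  multiplies by \<open>m / 2\<close>. The point \<open>1\<close> is exempt from the hypothesis, since one point does not
  affect the integrals.\<close>

lemma integral_tail_scale:
  fixes f :: "real \<Rightarrow> real"
  assumes f: "f integrable_on {0..1}"
    and scale: "\<And>s. 0 \<le> s \<Longrightarrow> s < 1 \<Longrightarrow> f ((1 + s) / 2) = m * f s"
    and t: "0 \<le> t" "t \<le> 1"
  shows "integral {(1 + t) / 2..1} f = m / 2 * integral {t..1} f"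
proof -
  have "f integrable_on cbox ((1 + t) / 2) 1"
    using integrable_on_subinterval[OF f, of "(1 + t) / 2" 1] t by simp
  then have "((\<lambda>s. f (1/2 * s + 1/2)) has_integral 2 * integral {(1 + t) / 2..1} f) {t..1}"
    using has_integral_affinity'[of f "integral {(1 + t) / 2..1} f" "(1 + t) / 2" 1 "1/2" "1/2"]
    by (simp add: integrable_integral field_simps)
  moreover have "((\<lambda>s. f (1/2 * s + 1/2)) has_integral m * integral {t..1} f) {t..1}"
  proof (rule has_integral_spike_finite[of "{1}"])
    show "f (1/2 * s + 1/2) = m * f s" if "s \<in> {t..1} - {1}" for s
      using scale[of s] that t by (simp add: add_divide_distrib add.commute)
    have "f integrable_on {t..1}"
      using integrable_on_subinterval[OF f, of t 1] t by simp
    then show "((\<lambda>s. m * f s) has_integral m * integral {t..1} f) {t..1}"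
      by (intro has_integral_mult_right integrable_integral)
  qed simp
  ultimately have "2 * integral {(1 + t) / 2..1} f = m * integral {t..1} f"
    by (rule has_integral_unique)
  then show ?thesis
    by simp
qed

section \<open>The processes for the self-similar control\<close>

lemma set_integrable_alpha_hat: "set_integrable lborel {0..1} alpha_hat"
  unfolding set_integrable_def
  by (rule integrableI_bounded_set_indicator[where B = 1]) (auto simp: abs_alpha_hat_le)

lemma alpha_hat_integrable_on: "alpha_hat integrable_on {0..1}"
  by (rule set_borel_integral_eq_integral(1)[OF set_integrable_alpha_hat])

lemma Y1_eq_integral: "0 \<le> t \<Longrightarrow> Y1 alpha_hat t = integral {t..1} alpha_hat"
  unfolding Y1_def
  by (rule set_borel_integral_eq_integral(2))
    (rule set_integrable_subset[OF set_integrable_alpha_hat], auto)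

lemma Y1_split:
  assumes "0 \<le> t" "t \<le> u" "u \<le> 1"
    and "(alpha_hat has_integral i) {t..u}"
  shows "Y1 alpha_hat t = i + Y1 alpha_hat u"
proof -
  have "alpha_hat integrable_on {t..1}"
    using integrable_on_subinterval[OF alpha_hat_integrable_on, of t 1] assms by simp
  then have "integral {t..u} alpha_hat + integral {u..1} alpha_hat = integral {t..1} alpha_hat"
    using assms by (intro Henstock_Kurzweil_Integration.integral_combine) auto
  then show ?thesis
    using assms by (simp add: Y1_eq_integral integral_unique)
qed

lemma alpha_hat_first:
  assumes "0 \<le> t"
  shows "t < 3/8 \<Longrightarrow> alpha_hat t = 1" "3/8 \<le> t \<Longrightarrow> t < 1/2 \<Longrightarrow> alpha_hat t = -1"
  using assms by (simp_all add: alpha_hat_eq_block_step block_step_first)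

lemma c_first:
  assumes "0 \<le> t"
  shows "t < 3/8 \<Longrightarrow> c t = 1" "3/8 \<le> t \<Longrightarrow> t < 1/2 \<Longrightarrow> c t = 6"
  using assms by (simp_all add: c_eq_block_step block_step_first)

text \<open>In the integrals over the two pieces of the first block, the right end point is discarded as
  a null set: when it is the end of its piece, the integrand already has the value of the next
  piece there.\<close>

lemma alpha_hat_has_integral_fst:
  assumes "0 \<le> t" "t \<le> u" "u \<le> 3/8"
  shows "(alpha_hat has_integral u - t) {t..u}"
  by (rule has_integral_spike_finite[of "{u}" _ _ "\<lambda>_. 1"])
    (use assms has_integral_const_real[of "1 :: real" t u] in \<open>auto simp: alpha_hat_first\<close>)

lemma alpha_hat_has_integral_snd:
  assumes "3/8 \<le> t" "t \<le> u" "u \<le> 1/2"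
  shows "(alpha_hat has_integral t - u) {t..u}"
  by (rule has_integral_spike_finite[of "{u}" _ _ "\<lambda>_. -1"])
    (use assms has_integral_const_real[of "-1 :: real" t u] in \<open>auto simp: alpha_hat_first\<close>)

lemma Y1_scale:
  assumes "0 \<le> t" "t \<le> 1"
  shows "Y1 alpha_hat ((1 + t) / 2) = Y1 alpha_hat t / 2"
  using integral_tail_scale[OF alpha_hat_integrable_on, of 1 t] assms
  by (simp add: Y1_eq_integral alpha_hat_scale)

lemma Y1_0: "Y1 alpha_hat 0 = 1/2"
proof -
  have "Y1 alpha_hat 0 = 3/8 + Y1 alpha_hat (3/8)"
    using Y1_split[OF _ _ _ alpha_hat_has_integral_fst[of 0 "3/8"]] by simp
  moreover have "Y1 alpha_hat (3/8) = -1/8 + Y1 alpha_hat (1/2)"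
    using Y1_split[OF _ _ _ alpha_hat_has_integral_snd[of "3/8" "1/2"]] by simp
  moreover have "Y1 alpha_hat (1/2) = Y1 alpha_hat 0 / 2"
    using Y1_scale[of 0] by simp
  ultimately show ?thesis by linarith
qed

lemma Y1_fst: "0 \<le> t \<Longrightarrow> t \<le> 3/8 \<Longrightarrow> Y1 alpha_hat t = 1/2 - t"
  using Y1_split[OF _ _ _ alpha_hat_has_integral_fst[of 0 t]] by (simp add: Y1_0)

lemma Y1_snd: "3/8 \<le> t \<Longrightarrow> t \<le> 1/2 \<Longrightarrow> Y1 alpha_hat t = t - 1/4"
  using Y1_split[OF _ _ _ alpha_hat_has_integral_snd[of "3/8" t]] by (simp add: Y1_fst)

lemma continuous_on_Y1: "continuous_on {0..1} (Y1 alpha_hat)"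
proof -
  have "continuous_on {0..1} (\<lambda>t. integral {t..1} alpha_hat)"
    by (rule indefinite_integral_continuous_1'[OF alpha_hat_integrable_on])
  then show ?thesis
    by (rule continuous_on_eq) (simp add: Y1_eq_integral)
qed

text \<open>The integrand of \<open>Y2\<close> for the control \<open>alpha_hat\<close>.\<close>

definition Y2_integrand :: "real \<Rightarrow> real" where
  "Y2_integrand s = c s * alpha_hat s * Y1 alpha_hat s"

lemma set_integrable_Y2_integrand: "set_integrable lborel {0..1} Y2_integrand"
proof -
  have "set_integrable lborel {0..1} (Y1 alpha_hat)"
    by (intro borel_integrable_atLeastAtMost' continuous_on_Y1)
  then have Y1: "integrable lborel (\<lambda>s. indicat_real {0..1} s *\<^sub>R Y1 alpha_hat s)"
    by (simp add: set_integrable_def)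
  \<comment> \<open>One indicator for each factor: \<open>Y1 alpha_hat\<close> is known to be measurable only on \<open>[0, 1]\<close>.\<close>
  have "integrable lborel
      (\<lambda>s. (indicat_real {0..1} s * (c s * alpha_hat s)) * (indicat_real {0..1} s *\<^sub>R Y1 alpha_hat s))"
  proof (rule Bochner_Integration.integrable_bound[OF integrable_mult_right[OF Y1, of 6]])
    show "(\<lambda>s. (indicat_real {0..1} s * (c s * alpha_hat s))
        * (indicat_real {0..1} s *\<^sub>R Y1 alpha_hat s)) \<in> borel_measurable lborel"
      using borel_measurable_integrable[OF Y1] by measurable
    have "\<bar>c s * alpha_hat s * Y1 alpha_hat s\<bar> \<le> 6 * \<bar>Y1 alpha_hat s\<bar>" if "0 \<le> s" for s
    proof -
      have "\<bar>c s\<bar> * \<bar>alpha_hat s\<bar> \<le> 6 * 1"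
        using that by (intro mult_mono abs_c_le abs_alpha_hat_le) auto
      then show ?thesis
        unfolding abs_mult by (intro mult_right_mono) auto
    qed
    then show "AE s in lborel. norm ((indicat_real {0..1} s * (c s * alpha_hat s))
        * (indicat_real {0..1} s *\<^sub>R Y1 alpha_hat s))
      \<le> norm (6 * (indicat_real {0..1} s *\<^sub>R Y1 alpha_hat s))"
      by (intro AE_I2) (auto simp: indicator_def abs_mult)
  qed
  then show ?thesis
    unfolding set_integrable_def
    by (rule Bochner_Integration.integrable_cong[THEN iffD1, rotated 2])
      (auto simp: Y2_integrand_def indicator_def)
qed

lemma Y2_integrand_integrable_on: "Y2_integrand integrable_on {0..1}"
  by (rule set_borel_integral_eq_integral(1)[OF set_integrable_Y2_integrand])

lemma Y2_eq_integral: "0 \<le> t \<Longrightarrow> Y2 alpha_hat t = integral {t..1} Y2_integrand"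
  unfolding Y2_def Y2_integrand_def[symmetric]
  by (rule set_borel_integral_eq_integral(2))
    (rule set_integrable_subset[OF set_integrable_Y2_integrand], auto)

lemma Y2_split:
  assumes "0 \<le> t" "t \<le> u" "u \<le> 1"
    and "(Y2_integrand has_integral i) {t..u}"
  shows "Y2 alpha_hat t = i + Y2 alpha_hat u"
proof -
  have "Y2_integrand integrable_on {t..1}"
    using integrable_on_subinterval[OF Y2_integrand_integrable_on, of t 1] assms by simp
  then have "integral {t..u} Y2_integrand + integral {u..1} Y2_integrand
      = integral {t..1} Y2_integrand"
    using assms by (intro Henstock_Kurzweil_Integration.integral_combine) auto
  then show ?thesis
    using assms by (simp add: Y2_eq_integral integral_unique)
qed

lemma Y2_scale:
  assumes "0 \<le> t" "t \<le> 1"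
  shows "Y2 alpha_hat ((1 + t) / 2) = Y2 alpha_hat t / 4"
  using integral_tail_scale[OF Y2_integrand_integrable_on, of "1/2" t] assms
  by (simp add: Y2_eq_integral Y2_integrand_def Y1_scale alpha_hat_scale c_scale)

lemma Y2_integrand_has_integral_fst:
  assumes "0 \<le> t" "t \<le> u" "u \<le> 3/8"
  shows "(Y2_integrand has_integral (u - u\<^sup>2) / 2 - (t - t\<^sup>2) / 2) {t..u}"
proof (rule has_integral_spike_finite[of "{u}"])
  show "((\<lambda>s. 1/2 - s) has_integral (u - u\<^sup>2) / 2 - (t - t\<^sup>2) / 2) {t..u}"
    using assms
    by (intro fundamental_theorem_of_calculus)
      (auto intro!: derivative_eq_intros simp flip: has_real_derivative_iff_has_vector_derivative)
  show "Y2_integrand s = 1/2 - s" if "s \<in> {t..u} - {u}" for s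
    using that assms by (simp add: Y2_integrand_def alpha_hat_first c_first Y1_fst)
qed simp

lemma Y2_integrand_has_integral_snd:
  assumes "3/8 \<le> t" "t \<le> u" "u \<le> 1/2"
  shows "(Y2_integrand has_integral 3 * (t - 1/4)\<^sup>2 - 3 * (u - 1/4)\<^sup>2) {t..u}"
proof (rule has_integral_spike_finite[of "{u}"])
  have "((\<lambda>s. - 6 * (s - 1/4)) has_integral (- 3 * (u - 1/4)\<^sup>2) - (- 3 * (t - 1/4)\<^sup>2)) {t..u}"
    using assms
    by (intro fundamental_theorem_of_calculus)
      (auto intro!: derivative_eq_intros simp flip: has_real_derivative_iff_has_vector_derivative)
  then show "((\<lambda>s. - 6 * (s - 1/4)) has_integral 3 * (t - 1/4)\<^sup>2 - 3 * (u - 1/4)\<^sup>2) {t..u}"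
    by simp
  show "Y2_integrand s = - 6 * (s - 1/4)" if "s \<in> {t..u} - {u}" for s
    using that assms by (simp add: Y2_integrand_def alpha_hat_first c_first Y1_snd)
qed simp

lemma Y2_0: "Y2 alpha_hat 0 = -1/32"
proof -
  have "Y2 alpha_hat 0 = 15/128 + Y2 alpha_hat (3/8)"
    using Y2_split[OF _ _ _ Y2_integrand_has_integral_fst[of 0 "3/8"]]
    by (simp add: power2_eq_square)
  moreover have "Y2 alpha_hat (3/8) = -18/128 + Y2 alpha_hat (1/2)"
    using Y2_split[OF _ _ _ Y2_integrand_has_integral_snd[of "3/8" "1/2"]]
    by (simp add: power2_eq_square)
  moreover have "Y2 alpha_hat (1/2) = Y2 alpha_hat 0 / 4"
    using Y2_scale[of 0] by simp
  ultimately show ?thesis by linarith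
qed

lemma Y2_neg:
  assumes "0 \<le> t" "t < 1"
  shows "Y2 alpha_hat t < 0"
  using assms
proof (rule scale_induct)
  fix t :: real
  assume t: "0 \<le> t" "t < 1/2"
  show "Y2 alpha_hat t < 0"
  proof (cases "t \<le> 3/8")
    case True
    then have "Y2 alpha_hat t = -1/32 - (t - t\<^sup>2) / 2"
      using Y2_split[OF _ _ _ Y2_integrand_has_integral_fst[of 0 t]] t by (simp add: Y2_0)
    moreover have "t\<^sup>2 \<le> t"
      using t by (simp add: power2_eq_square mult_left_le)
    ultimately show ?thesis by simp
  next
    case False
    then have "Y2 alpha_hat t = 3 * (t - 1/4)\<^sup>2 - 3 * (1/4)\<^sup>2 + Y2 alpha_hat (1/2)"
      using Y2_split[OF _ _ _ Y2_integrand_has_integral_snd[of t "1/2"]] t by simp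
    moreover have "Y2 alpha_hat (1/2) = -1/128"
      using Y2_scale[of 0] by (simp add: Y2_0)
    moreover have "(t - 1/4)\<^sup>2 \<le> (1/4)\<^sup>2"
      using t False by (intro power_mono) auto
    ultimately show ?thesis by linarith
  qed
next
  fix t :: real
  assume "0 \<le> t" "t < 1" "Y2 alpha_hat t < 0"
  then show "Y2 alpha_hat ((1 + t) / 2) < 0"
    by (simp add: Y2_scale)
qed

section \<open>Domination of the zero control\<close>

lemma J_alpha_star: "J t alpha_star = 0"
  by (simp add: J_def Y2_def alpha_star_def)

lemma alpha_star_admissible: "alpha_star \<in> admissible"
  by (simp add: admissible_def alpha_star_def[abs_def])

lemma alpha_hat_admissible: "alpha_hat \<in> admissible"
  using abs_alpha_hat_le
  by (auto simp: admissible_def abs_le_iff minus_le_iff intro: measurable_restrict_space1)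

theorem proposition2p3:
  shows "alpha_star \<in> admissible \<and> alpha_hat \<in> admissible
    \<and> (\<forall>t\<in>{0..<T}. J t alpha_hat < J t alpha_star)
    \<and> J T alpha_hat = J T alpha_star"
proof (intro conjI ballI)
  show "J t alpha_hat < J t alpha_star" if "t \<in> {0..<1}" for t
    using that Y2_neg[of t] unfolding J_alpha_star by (simp add: J_def)
  show "J 1 alpha_hat = J 1 alpha_star"
    unfolding J_alpha_star by (simp add: J_def Y2_eq_integral)
qed (fact alpha_star_admissible alpha_hat_admissible)+

end
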